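(* Let $n,m\ge 1$ be integers and let $Q := \{(\mathbf{x},\mathbf{y})\in\mathbb{R}^n\times\mathbb{R}^m : \|\mathbf{x}\|\le\|\mathbf{y}\|\}$. Let $\Gamma : D^m\to D^n$ be a function and define $$C_\Gamma := \{(\mathbf{x},\mathbf{y}) \in \mathbb{R}^n \times \mathbb{R}^m : \Gamma(\boldsymbol{\beta})^\top \mathbf{x} - \boldsymbol{\beta}^\top \mathbf{y} \ge 0 \ \text{ for all } \boldsymbol{\beta} \in D^m\}.$$ If $\Gamma$ is strictly non-expansive, then $C_\Gamma$ is a full-dimensional maximal $Q$-free set.
   Context: $\|\cdot\|$ is the Euclidean norm, and $D^k := \{\mathbf{x}\in\mathbb{R}^k : \|\mathbf{x}\|=1\}$. A function $\Gamma: D^m\to D^n$ is strictly non-expansive if $\|\Gamma(\boldsymbol{\beta})-\Gamma(\boldsymbol{\beta}')\|<\|\boldsymbol{\beta}-\boldsymbol{\beta}'\|$ for every pair of distinct points $\boldsymbol{\beta},\boldsymbol{\beta}'\in D^m$. Given a closed set $S\subseteq\mathbb{R}^d$, a closed convex set $C\subseteq\mathbb{R}^d$ is $S$-free if its interior contains no point of $S$; it is a maximal $S$-free set if it is $S$-free and is not strictly contained in another ($S$-free, closed convex) set. $Q$-free means $S$-free with $S=Q$ in $\mathbb{R}^n\times\mathbb{R}^m$. A convex set is full-dimensional if it has nonempty interior. *)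

theory Defs
  imports "HOL-Analysis.Analysis"
begin

text \<open>Following the usual convention, \<open>S\<close> is a closed set wherever these two
  notions are applied; closedness of \<open>S\<close> is not part of the definitions.\<close>

definition S_free :: "'a::euclidean_space set \<Rightarrow> 'a set \<Rightarrow> bool" where
  "S_free S C \<longleftrightarrow> closed C \<and> convex C \<and> interior C \<inter> S = {}"

definition maximal_S_free :: "'a::euclidean_space set \<Rightarrow> 'a set \<Rightarrow> bool" where
  "maximal_S_free S C \<longleftrightarrow> S_free S C \<and> \<not> (\<exists>C'. S_free S C' \<and> C \<subset> C')"

definition full_dimensional :: "'a::euclidean_space set \<Rightarrow> bool" where
  "full_dimensional C \<longleftrightarrow> convex C \<and> interior C \<noteq> {}"

text \<open>The type \<open>(real ^ 'n) \<times> (real ^ 'm)\<close> is the Euclidean space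
  \<open>\<real>\<^sup>n \<times> \<real>\<^sup>m\<close> with \<open>n = CARD('n) \<ge> 1\<close> and \<open>m = CARD('m) \<ge> 1\<close>.\<close>

definition Q :: "((real ^ 'n) \<times> (real ^ 'm)) set" where
  "Q = {(x, y). norm x \<le> norm y}"

text \<open>A map between unit spheres is represented by a total function that is only ever
  constrained and evaluated on \<open>sphere 0 1\<close>.\<close>

definition C_of :: "(real ^ 'm \<Rightarrow> real ^ 'n) \<Rightarrow> ((real ^ 'n) \<times> (real ^ 'm)) set" where
  "C_of \<Gamma> = {(x, y). \<forall>\<beta>\<in>sphere 0 1. \<Gamma> \<beta> \<bullet> x - \<beta> \<bullet> y \<ge> 0}"

definition strictly_nonexpansive :: "(real ^ 'm \<Rightarrow> real ^ 'n) \<Rightarrow> bool" where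
  "strictly_nonexpansive \<Gamma> \<longleftrightarrow>
    (\<forall>\<beta>\<in>sphere 0 1. \<forall>\<beta>'\<in>sphere 0 1.
      \<beta> \<noteq> \<beta>' \<longrightarrow> norm (\<Gamma> \<beta> - \<Gamma> \<beta>') < norm (\<beta> - \<beta>'))"

end

theory Submission
  imports Defs
begin

text \<open>\<open>C_of \<Gamma>\<close> is the dual cone of the compact set \<open>K\<close> of the vectors \<open>(\<Gamma> \<beta>, - \<beta>)\<close>. For unit
  vectors, \<open>norm (u - v)\<^sup>2 = 2 - 2 * (u \<bullet> v)\<close>, so strict non-expansiveness says that the point
  \<open>p = (\<Gamma> \<beta>, \<beta>)\<close> of \<open>Q\<close> is orthogonal to \<open>(\<Gamma> \<beta>, - \<beta>)\<close> and makes a positive inner product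
  with every other element of \<open>K\<close>: each element of \<open>K\<close> is exposed by a point of \<open>Q\<close>. Hence
  \<open>0\<close> is not in the convex hull of \<open>K\<close>, and separation yields an interior point of the cone.
  If a convex set containing the cone contains a point \<open>z\<close> violating the inequality of \<open>k \<in> K\<close>,
  then moving from the point \<open>p\<close> that exposes \<open>k\<close> slightly away from \<open>z\<close> leads into the interior
  of the cone, so that \<open>p\<close> is an interior point of the larger set.\<close>

definition dual_cone :: "'a::real_inner set \<Rightarrow> 'a set" where
  "dual_cone K = {v. \<forall>k\<in>K. 0 \<le> k \<bullet> v}"

text \<open>For \<open>k \<in> K\<close> this makes \<open>p\<close> a point of
  \<open>dual_cone K\<close> at which the inequality of \<open>k\<close>, and no other, is
  tight.\<close>

definition exposes :: "'a::real_inner set \<Rightarrow> 'a \<Rightarrow> 'a \<Rightarrow> bool" where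
  "exposes K k p \<longleftrightarrow> k \<bullet> p = 0 \<and> (\<forall>k'\<in>K - {k}. 0 < k' \<bullet> p)"

lemma dual_cone_Inter: "dual_cone K = (\<Inter>k\<in>K. {v. 0 \<le> k \<bullet> v})"
  by (auto simp: dual_cone_def)

lemma closed_dual_cone: "closed (dual_cone K)"
  unfolding dual_cone_Inter by (intro closed_INT ballI closed_halfspace_ge)

lemma convex_dual_cone: "convex (dual_cone K)"
  unfolding dual_cone_Inter by (intro convex_INT convex_halfspace_ge)

text \<open>An interior point of the cone is interior to the half-space of each nonzero
  \<open>k\<close>. Conversely, compactness turns pointwise positivity into a positive minimum over
  \<open>K\<close>, which survives small perturbations of \<open>v\<close>.\<close>

lemma interior_dual_cone:
  fixes K :: "'a::euclidean_space set"
  assumes K: "compact K" and nz: "0 \<notin> K"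
  shows "interior (dual_cone K) = {v. \<forall>k\<in>K. 0 < k \<bullet> v}"
proof (intro equalityI subsetI CollectI ballI)
  fix v k assume v: "v \<in> interior (dual_cone K)" and k: "k \<in> K"
  have "interior (dual_cone K) \<subseteq> interior {v. k \<bullet> v \<ge> 0}"
    using k by (intro interior_mono) (auto simp: dual_cone_def)
  moreover have "k \<noteq> 0" using k nz by blast
  ultimately show "0 < k \<bullet> v"
    using v by (auto simp: interior_halfspace_ge)
next
  fix v assume "v \<in> {v. \<forall>k\<in>K. 0 < k \<bullet> v}"
  then have pos: "\<And>k. k \<in> K \<Longrightarrow> 0 < k \<bullet> v" by blast
  show "v \<in> interior (dual_cone K)"
  proof (cases "K = {}")
    case True
    then show ?thesis by (simp add: dual_cone_def)
  next
    case False
    have "continuous_on K (\<lambda>k. k \<bullet> v)" by (intro continuous_intros)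
    then obtain k0 where k0: "k0 \<in> K" "\<And>k. k \<in> K \<Longrightarrow> k0 \<bullet> v \<le> k \<bullet> v"
      using continuous_attains_inf[OF K False] by blast
    obtain B where B: "0 < B" "\<And>k. k \<in> K \<Longrightarrow> norm k \<le> B"
      using compact_imp_bounded[OF K] bounded_pos by metis
    \<comment> \<open>The radius is the minimum value divided by the norm bound: moving
      \<open>v\<close> by less lowers each \<open>k \<bullet> v\<close> by less than that
      minimum.\<close>
    have "ball v (k0 \<bullet> v / B) \<subseteq> dual_cone K"
    proof
      fix w assume "w \<in> ball v (k0 \<bullet> v / B)"
      then have w: "B * norm (v - w) < k0 \<bullet> v"
        using B(1) by (simp add: dist_norm field_simps)
      show "w \<in> dual_cone K"
        unfolding dual_cone_def
      proof (intro CollectI ballI)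
        fix k assume k: "k \<in> K"
        have "k \<bullet> (v - w) \<le> norm k * norm (v - w)" by (rule norm_cauchy_schwarz)
        also have "\<dots> \<le> B * norm (v - w)" using B(2)[OF k] by (intro mult_right_mono) auto
        finally show "0 \<le> k \<bullet> w"
          using w k0(2)[OF k] by (simp add: inner_diff_right)
      qed
    qed
    then show ?thesis
      using pos[OF k0(1)] B(1) by (intro interiorI[OF open_ball]) auto
  qed
qed

text \<open>Pair a vanishing convex combination with the point exposing some \<open>k\<close> of
  nonzero weight. All terms are nonnegative, so every other weight vanishes and \<open>k\<close>
  itself would be 0.\<close>

lemma exposes_imp_zero_notin_hull:
  fixes K :: "'a::euclidean_space set"
  assumes nz: "0 \<notin> K" and ex: "\<And>k. k \<in> K \<Longrightarrow> \<exists>p. exposes K k p"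
  shows "0 \<notin> convex hull K"
proof
  assume "0 \<in> convex hull K"
  then obtain S u where S: "finite S" "S \<subseteq> K" and u: "\<And>k. k \<in> S \<Longrightarrow> 0 \<le> u k"
    and u1: "sum u S = (1::real)" and u0: "(\<Sum>k\<in>S. u k *\<^sub>R k) = 0"
    by (auto simp: convex_hull_explicit)
  obtain k where k: "k \<in> S" "u k \<noteq> 0"
    using u1 by (metis sum.neutral zero_neq_one)
  obtain p where p: "exposes K k p" using ex k S by blast
  have "(\<Sum>l\<in>S. u l * (l \<bullet> p)) = (\<Sum>l\<in>S. u l *\<^sub>R l) \<bullet> p"
    by (simp add: inner_sum_left)
  then have "(\<Sum>l\<in>S. u l * (l \<bullet> p)) = 0" using u0 by simp
  moreover have "0 \<le> u l * (l \<bullet> p)" if "l \<in> S" for l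
    using that u S p unfolding exposes_def
    by (metis DiffI insertE empty_iff less_eq_real_def mult_nonneg_nonneg subsetD)
  ultimately have "\<forall>l\<in>S. u l * (l \<bullet> p) = 0"
    using S(1) by (simp add: sum_nonneg_eq_0_iff)
  moreover have "0 < l \<bullet> p" if "l \<in> S - {k}" for l
    using that S(2) p unfolding exposes_def by blast
  ultimately have "u l = 0" if "l \<in> S - {k}" for l
    using that by fastforce
  then have "(\<Sum>l\<in>S. u l *\<^sub>R l) = u k *\<^sub>R k"
    using S(1) k(1) by (simp add: sum.remove)
  then show False using u0 k nz S(2) by auto
qed

text \<open>The normal of a hyperplane strictly separating 0 from the compact hull is an interior
  point.\<close>

lemma interior_dual_cone_nonempty:
  fixes K :: "'a::euclidean_space set"
  assumes K: "compact K" and "0 \<notin> convex hull K"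
  shows "interior (dual_cone K) \<noteq> {}"
proof -
  obtain a b where ab: "0 < b" "\<And>k. k \<in> convex hull K \<Longrightarrow> a \<bullet> k > b"
    using separating_hyperplane_closed_0[OF convex_convex_hull _ assms(2)]
      compact_imp_closed[OF compact_convex_hull[OF K]] by metis
  have "0 < k \<bullet> a" if "k \<in> K" for k
    using ab(1) ab(2)[OF hull_inc[OF that]] by (simp add: inner_commute)
  moreover have "0 \<notin> K" using assms(2) hull_inc by metis
  ultimately show ?thesis using K by (auto simp: interior_dual_cone)
qed

text \<open>Prolonging the segment from \<open>z\<close> to \<open>p\<close> slightly beyond
  \<open>p\<close> reaches a point \<open>q\<close> interior to the cone, and \<open>p\<close> then
  lies strictly between \<open>z\<close> and \<open>q\<close>.\<close>

lemma exposing_point_mem_interior: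
  fixes K :: "'a::euclidean_space set"
  assumes K: "compact K" and nz: "0 \<notin> K" and p: "exposes K k p"
    and C: "convex C" "dual_cone K \<subseteq> C" and z: "z \<in> C" "k \<bullet> z < 0"
  shows "p \<in> interior C"
proof -
  have p0: "0 \<le> l \<bullet> p" if "l \<in> K" for l
    using p that unfolding exposes_def by (cases "l = k") (auto intro: less_imp_le)
  \<comment> \<open>Only those \<open>l\<close> with \<open>0 \<le> l \<bullet> z\<close> limit the
    step length. They form a compact set that omits \<open>k\<close>, so
    \<open>l \<bullet> p\<close> is positive on it and the ratio
    \<open>l \<bullet> z / (l \<bullet> p)\<close> is bounded.\<close>
  obtain t where t: "0 < t" "\<And>l. l \<in> K \<Longrightarrow> 0 \<le> l \<bullet> z \<Longrightarrow> t * (l \<bullet> z) < l \<bullet> p"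
  proof (cases "K \<inter> {l. 0 \<le> z \<bullet> l} = {}")
    case True
    then show ?thesis using that[of 1] by (auto simp: inner_commute)
  next
    case False
    let ?A = "K \<inter> {l. 0 \<le> z \<bullet> l}"
    have A: "compact ?A" using K closed_halfspace_ge[of 0 z] by (intro compact_Int_closed) auto
    have pos: "0 < l \<bullet> p" if "l \<in> ?A" for l
      using p that z(2) unfolding exposes_def by (auto simp: inner_commute)
    have "continuous_on ?A (\<lambda>l. l \<bullet> z / (l \<bullet> p))"
      using pos by (intro continuous_intros) fastforce+
    then obtain M where M: "l \<in> ?A \<Longrightarrow> l \<bullet> z / (l \<bullet> p) \<le> M" for l
      using continuous_attains_sup[OF A False] by blast
    \<comment> \<open>The number \<open>\<bar>M\<bar> + 1\<close> is positive whatever the sign of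
      \<open>M\<close>, and strictly exceeds every ratio.\<close>
    define t where "t = 1 / (\<bar>M\<bar> + 1)"
    show ?thesis
    proof (rule that[of t])
      show "0 < t" by (simp add: t_def)
      fix l assume "l \<in> K" "0 \<le> l \<bullet> z"
      then have l: "l \<in> ?A" by (simp add: inner_commute)
      have "l \<bullet> z / (l \<bullet> p) < \<bar>M\<bar> + 1" using M[OF l] by linarith
      then show "t * (l \<bullet> z) < l \<bullet> p"
        using pos[OF l] by (simp add: t_def field_simps)
    qed
  qed
  define q where "q = p + t *\<^sub>R (p - z)"
  have "0 < l \<bullet> q" if l: "l \<in> K" for l
  proof -
    have "l \<bullet> q = l \<bullet> p + t * (l \<bullet> p) - t * (l \<bullet> z)"
      by (simp add: q_def inner_simps algebra_simps)
    moreover have "0 \<le> t * (l \<bullet> p)" using p0[OF l] t(1) by simp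
    moreover have "t * (l \<bullet> z) < l \<bullet> p"
    proof (cases "0 \<le> l \<bullet> z")
      case False
      then have "t * (l \<bullet> z) < 0" using t(1) by (simp add: mult_pos_neg)
      then show ?thesis using p0[OF l] by simp
    qed (use t(2) l in blast)
    ultimately show ?thesis by linarith
  qed
  then have "q \<in> interior (dual_cone K)" using K nz by (simp add: interior_dual_cone)
  then have q: "q \<in> interior C" using interior_mono[OF C(2)] by blast
  \<comment> \<open>The factor \<open>1 / (1 + t)\<close> is the one for which shrinking from
    \<open>q\<close> towards \<open>z\<close> lands exactly on \<open>p\<close>.\<close>
  have "z - (1 / (1 + t)) *\<^sub>R (z - q) \<in> interior C"
    using t(1) by (intro mem_interior_convex_shrink[OF C(1) q z(1)]) auto
  moreover have "z - q = (1 + t) *\<^sub>R (z - p)" by (simp add: q_def algebra_simps)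
  then have "z - (1 / (1 + t)) *\<^sub>R (z - q) = p" using t(1) by simp
  ultimately show ?thesis by simp
qed

lemma maximal_S_free_dual_cone:
  fixes K :: "'a::euclidean_space set"
  assumes K: "compact K" and nz: "0 \<notin> K" and free: "S_free S (dual_cone K)"
    and ex: "\<And>k. k \<in> K \<Longrightarrow> \<exists>p\<in>S. exposes K k p"
  shows "maximal_S_free S (dual_cone K)"
  unfolding maximal_S_free_def
proof (intro conjI notI free)
  assume "\<exists>C. S_free S C \<and> dual_cone K \<subset> C"
  then obtain C z where C: "S_free S C" "dual_cone K \<subseteq> C" and z: "z \<in> C" "z \<notin> dual_cone K"
    by blast
  then obtain k where k: "k \<in> K" "k \<bullet> z < 0" by (auto simp: dual_cone_def not_le)
  then obtain p where p: "p \<in> S" "exposes K k p" using ex by blast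
  have "p \<in> interior C"
    using exposing_point_mem_interior[OF K nz p(2) _ C(2) z(1) k(2)] C(1)
    by (simp add: S_free_def)
  then show False using p(1) C(1) by (auto simp: S_free_def)
qed

theorem corollary1:
  fixes \<Gamma> :: "real ^ 'm \<Rightarrow> real ^ 'n"
  assumes "\<Gamma> \<in> sphere 0 1 \<rightarrow> sphere 0 1"
    and "strictly_nonexpansive \<Gamma>"
  shows "full_dimensional (C_of \<Gamma>) \<and> maximal_S_free Q (C_of \<Gamma>)"
proof -
  define K where "K = (\<lambda>\<beta>. (\<Gamma> \<beta>, - \<beta>)) ` sphere 0 1"
  have C: "C_of \<Gamma> = dual_cone K"
    by (auto simp: C_of_def dual_cone_def K_def)
  have \<Gamma>1: "norm (\<Gamma> \<beta>) = 1" if "norm \<beta> = 1" for \<beta>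
    using assms(1) that by (auto simp: Pi_iff)
  have ne: "norm (\<Gamma> \<beta> - \<Gamma> \<gamma>) < norm (\<beta> - \<gamma>)" if "norm \<beta> = 1" "norm \<gamma> = 1" "\<beta> \<noteq> \<gamma>" for \<beta> \<gamma>
    using assms(2) that by (auto simp: strictly_nonexpansive_def)
  \<comment> \<open>Non-expansiveness supplies the continuity of \<open>\<Gamma>\<close> that makes
    \<open>K\<close> compact.\<close>
  have "1-lipschitz_on (sphere 0 1) \<Gamma>"
    using ne by (intro lipschitz_onI) (force simp: dist_norm intro: less_imp_le)+
  then have "continuous_on (sphere 0 1) \<Gamma>"
    by (rule lipschitz_on_continuous_on)
  then have K: "compact K"
    unfolding K_def by (intro compact_continuous_image continuous_intros compact_sphere)
  have nz: "0 \<notin> K" by (auto simp: K_def zero_prod_def)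
  have ex: "\<exists>p\<in>Q. exposes K k p" if k: "k \<in> K" for k
  proof -
    obtain \<beta> where \<beta>: "norm \<beta> = 1" "k = (\<Gamma> \<beta>, - \<beta>)" using k by (auto simp: K_def)
    have "0 < \<Gamma> \<gamma> \<bullet> \<Gamma> \<beta> - \<gamma> \<bullet> \<beta>" if \<gamma>: "norm \<gamma> = 1" "\<gamma> \<noteq> \<beta>" for \<gamma>
    proof -
      have "(norm (\<Gamma> \<gamma> - \<Gamma> \<beta>))\<^sup>2 < (norm (\<gamma> - \<beta>))\<^sup>2"
        using ne[OF \<gamma>(1) \<beta>(1) \<gamma>(2)] by (intro power_strict_mono) auto
      then show ?thesis
        using \<Gamma>1 \<gamma>(1) \<beta>(1) by (simp add: dot_norm_neg)
    qed
    moreover have "\<Gamma> \<beta> \<bullet> \<Gamma> \<beta> - \<beta> \<bullet> \<beta> = 0"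
      using \<Gamma>1 \<beta>(1) by (simp add: dot_square_norm)
    ultimately have "exposes K k (\<Gamma> \<beta>, \<beta>)"
      unfolding exposes_def K_def \<beta>(2) by fastforce
    moreover have "(\<Gamma> \<beta>, \<beta>) \<in> Q" using \<Gamma>1 \<beta>(1) by (simp add: Q_def)
    ultimately show ?thesis by blast
  qed
  have "interior (dual_cone K) \<inter> Q = {}"
  proof (intro equals0I)
    fix v assume v: "v \<in> interior (dual_cone K) \<inter> Q"
    obtain x y where xy: "v = (x, y)" "norm x \<le> norm y" using v by (auto simp: Q_def)
    have pos: "0 < \<Gamma> \<beta> \<bullet> x - \<beta> \<bullet> y" if "norm \<beta> = 1" for \<beta>
      using v that unfolding interior_dual_cone[OF K nz] by (auto simp: K_def xy(1))
    \<comment> \<open>The direction of \<open>y\<close>, or any unit vector if \<open>y = 0\<close>.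
      Its inequality fails to be strict, since \<open>\<Gamma> \<beta> \<bullet> x \<le> norm x
      \<le> norm y = \<beta> \<bullet> y\<close>.\<close>
    obtain \<beta> where \<beta>: "norm \<beta> = 1" "\<beta> \<bullet> y = norm y"
    proof (cases "y = 0")
      case True
      then show ?thesis using that[of "axis undefined 1"] by simp
    next
      case False
      then show ?thesis
        using that[of "y /\<^sub>R norm y"] by (simp add: dot_square_norm power2_eq_square)
    qed
    have "\<Gamma> \<beta> \<bullet> x \<le> norm x" using norm_cauchy_schwarz[of "\<Gamma> \<beta>" x] \<Gamma>1[OF \<beta>(1)] by simp
    then show False using pos[OF \<beta>(1)] \<beta>(2) xy(2) by simp
  qed
  then have "S_free Q (dual_cone K)"
    by (simp add: S_free_def closed_dual_cone convex_dual_cone)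
  then have "maximal_S_free Q (dual_cone K)"
    using maximal_S_free_dual_cone[OF K nz _ ex] by blast
  moreover have "0 \<notin> convex hull K"
    using exposes_imp_zero_notin_hull[OF nz] ex by blast
  then have "full_dimensional (dual_cone K)"
    using interior_dual_cone_nonempty[OF K] by (simp add: full_dimensional_def convex_dual_cone)
  ultimately show ?thesis by (simp add: C)
qed

end
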